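(* Let $(\mathfrak g,\mu,T)$ be a Rota-Baxter $3$-Lie algebra of weight $\lambda$, and let $(\mathfrak g[[t]],\mu_t,T_t)$ and $(\mathfrak g[[t]],\mu'_t,T'_t)$ be two equivalent $1$-parameter formal deformations of $(\mathfrak g,\mu,T)$. Then their infinitesimals $(\mu_1,T_1)$ and $(\mu_1',T_1')$ are in the same cohomology class in the second cohomology group of the Rota-Baxter $3$-Lie algebra $(\mathfrak g,\mu,T)$ with coefficients in its adjoint representation.
   Context: Let $k$ be a field of characteristic $0$; vector spaces are over $k$; $\lambda\in k$. A $3$-Lie algebra is a vector space $\mathfrak g$ with a linear map $\mu=[\cdot,\cdot,\cdot]:\wedge^3\mathfrak g\to\mathfrak g$ such that $[x_1,x_2,[x_3,x_4,x_5]]=[[x_1,x_2,x_3],x_4,x_5]+[x_3,[x_1,x_2,x_4],x_5]+[x_3,x_4,[x_1,x_2,x_5]]$. A Rota-Baxter $3$-Lie algebra of weight $\lambda$ is a $3$-Lie algebra with a linear map $T:\mathfrak g\to\mathfrak g$ such that $[T(x),T(y),T(z)]=T([x,y,z]_T)$, where $[x,y,z]_T:=[T(x),T(y),z]+[T(x),y,T(z)]+[x,T(y),T(z)]+\lambda[T(x),y,z]+\lambda[x,T(y),z]+\lambda[x,y,T(z)]+\lambda^2[x,y,z]$. The same definitions are used over the ring $k[[t]]$. A $1$-parameter formal deformation of $(\mathfrak g,\mu,T)$ is a pair of power series $\mu_t=\sum_{i\ge0}\mu_it^i$, $T_t=\sum_{i\ge0}T_it^i$ with $\mu_i\in\mathrm{Hom}(\wedge^3\mathfrak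 g,\mathfrak g)$, $T_i\in\mathrm{Hom}(\mathfrak g,\mathfrak g)$, which (extended $k[[t]]$-linearly) endow $\mathfrak g[[t]]$ with the structure of a Rota-Baxter $3$-Lie algebra of weight $\lambda$ over $k[[t]]$, and such that $(\mu_0,T_0)=(\mu,T)$. Its infinitesimal is $(\mu_1,T_1)$; it is known to be a $2$-cocycle as defined below. Two deformations $(\mu_t,T_t)$, $(\mu_t',T_t')$ are equivalent if there is a power series $\psi_t=\sum_{i\ge0}\psi_it^i$ with linear maps $\psi_i:\mathfrak g\to\mathfrak g$, $\psi_0=\mathrm{Id}_{\mathfrak g}$, such that (extended $k[[t]]$-linearly) $\psi_t\circ\mu_t'=\mu_t\circ(\psi_t\otimes\psi_t\otimes\psi_t)$ and $\psi_t\circ T_t'=T_t\circ\psi_t$. Second cohomology group (adjoint coefficients). Put $\rho(x,y)z=[x,y,z]$ and $\rho_T(x,y)z=[T(x),T(y),z]-T\big([T(x),y,z]+[x,T(y),z]+\lambda[x,y,z]\big)$. The $1$-cochains are $\mathrm{Hom}(\mathfrak g,\mathfrak g)\oplus\mathfrak g$ and the $2$-cochains are $\mathrm{Hom}(\wedge^3\mathfrak g,\mathfrak g)\oplus\mathrm{Hom}(\mathfrak g,\mathfrak g)$. The differentials are $d^1(f,a)=(\delta^1f,-\partial^0a-\Phi^1f)$ with $\partial^0=0$, and $d^2(f,g)=(\delta^2f,-\partial^1g-\Phi^2f)$, where $(\delta^1f)(x,y,z)=-f([x,y,z])+\rho(x,y)f(z)+\rho(y,z)f(x)+\rho(z,x)f(y)$;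 $\Phi^1f=f\circ T-T\circ f$; $(\delta^2f)(x_1,\dots,x_5)=-f([x_1,x_2,x_3],x_4,x_5)-f(x_3,[x_1,x_2,x_4],x_5)-f(x_3,x_4,[x_1,x_2,x_5])+f(x_1,x_2,[x_3,x_4,x_5])+\rho(x_1,x_2)f(x_3,x_4,x_5)-\rho(x_3,x_4)f(x_1,x_2,x_5)-\rho(x_4,x_5)f(x_1,x_2,x_3)-\rho(x_5,x_3)f(x_1,x_2,x_4)$; $(\partial^1g)(x,y,z)=-g([x,y,z]_T)+\rho_T(x,y)g(z)+\rho_T(y,z)g(x)+\rho_T(z,x)g(y)$; $(\Phi^2f)(x,y,z)=f(T(x),T(y),T(z))-T\big(f(T(x),T(y),z)+f(T(x),y,T(z))+f(x,T(y),T(z))+\lambda f(T(x),y,z)+\lambda f(x,T(y),z)+\lambda f(x,y,T(z))+\lambda^2f(x,y,z)\big)$. The second cohomology group is $\ker d^2/\operatorname{im}d^1$. *)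

theory Defs
  imports
    "HOL-Algebra.Coset"
    "HOL-Computational_Algebra.Formal_Power_Series"
    "HOL-Library.Function_Algebras"
    "HOL-Library.Product_Plus"
begin

text \<open>
  Modules are given by their scalar multiplication \<open>s\<close>, in the sense of the library locale
  \<open>module\<close>; the underlying module is the whole type. Over a field these are the
  vector spaces. The ring is kept general because the same definitions are used over \<open>k\<close>
  and over \<open>k[[t]]\<close>.
\<close>

section \<open>Rota-Baxter 3-Lie algebras\<close>

text \<open>
  \<open>alt_trilinear s f\<close> says that \<open>f\<close> is an element of \<open>Hom(\<Lambda>\<^sup>3 V, V)\<close>, via the universal
  property of the exterior power.
\<close>

definition alt_trilinear ::
  "('r::comm_ring_1 \<Rightarrow> 'v::ab_group_add \<Rightarrow> 'v) \<Rightarrow> ('v \<Rightarrow> 'v \<Rightarrow> 'v \<Rightarrow> 'v) \<Rightarrow> bool" where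
  "alt_trilinear s f \<longleftrightarrow>
     (\<forall>y z. module_hom s s (\<lambda>x. f x y z)) \<and>
     (\<forall>x z. module_hom s s (\<lambda>y. f x y z)) \<and>
     (\<forall>x y. module_hom s s (\<lambda>z. f x y z)) \<and>
     (\<forall>x y. f x x y = 0 \<and> f x y x = 0 \<and> f y x x = 0)"

definition three_Lie_algebra ::
  "('r::comm_ring_1 \<Rightarrow> 'v::ab_group_add \<Rightarrow> 'v) \<Rightarrow> ('v \<Rightarrow> 'v \<Rightarrow> 'v \<Rightarrow> 'v) \<Rightarrow> bool" where
  "three_Lie_algebra s \<mu> \<longleftrightarrow>
     module s \<and> alt_trilinear s \<mu> \<and>
     (\<forall>x1 x2 x3 x4 x5.
        \<mu> x1 x2 (\<mu> x3 x4 x5) =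
          \<mu> (\<mu> x1 x2 x3) x4 x5 + \<mu> x3 (\<mu> x1 x2 x4) x5 + \<mu> x3 x4 (\<mu> x1 x2 x5))"

text \<open>
  \<open>derived_op s l T \<mu> x y z\<close> is the bracket \<open>[x, y, z]\<^sub>T\<close>. It is stated for an arbitrary ternary
  operation \<open>f\<close> in place of the bracket, because the same expression occurs in \<open>\<Phi>\<^sup>2 f\<close>.
\<close>

definition derived_op ::
  "('r::comm_ring_1 \<Rightarrow> 'v::ab_group_add \<Rightarrow> 'v) \<Rightarrow> 'r \<Rightarrow> ('v \<Rightarrow> 'v) \<Rightarrow>
   ('v \<Rightarrow> 'v \<Rightarrow> 'v \<Rightarrow> 'v) \<Rightarrow> 'v \<Rightarrow> 'v \<Rightarrow> 'v \<Rightarrow> 'v" where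
  "derived_op s l T f x y z =
     f (T x) (T y) z + f (T x) y (T z) + f x (T y) (T z)
     + s l (f (T x) y z) + s l (f x (T y) z) + s l (f x y (T z))
     + s (l ^ 2) (f x y z)"

definition Rota_Baxter_three_Lie_algebra ::
  "('r::comm_ring_1 \<Rightarrow> 'v::ab_group_add \<Rightarrow> 'v) \<Rightarrow> 'r \<Rightarrow>
   ('v \<Rightarrow> 'v \<Rightarrow> 'v \<Rightarrow> 'v) \<Rightarrow> ('v \<Rightarrow> 'v) \<Rightarrow> bool" where
  "Rota_Baxter_three_Lie_algebra s l \<mu> T \<longleftrightarrow>
     three_Lie_algebra s \<mu> \<and> module_hom s s T \<and>
     (\<forall>x y z. \<mu> (T x) (T y) (T z) = T (derived_op s l T \<mu> x y z))"

section \<open>Formal deformations\<close>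

text \<open>The elements of \<open>V[[t]]\<close> are the formal power series of type \<open>'v fps\<close>.\<close>

definition fps_scale ::
  "('k::comm_ring_1 \<Rightarrow> 'v::ab_group_add \<Rightarrow> 'v) \<Rightarrow> 'k fps \<Rightarrow> 'v fps \<Rightarrow> 'v fps" where
  "fps_scale s c v = Abs_fps (\<lambda>n. \<Sum>i\<le>n. s (fps_nth c i) (fps_nth v (n - i)))"

text \<open>
  The \<open>k[[t]]\<close>-linear extensions of a power series \<open>\<Sum>\<^sub>i F\<^sub>i t\<^sup>i\<close> of linear maps and of a power
  series \<open>\<Sum>\<^sub>i M\<^sub>i t\<^sup>i\<close> of trilinear maps, where the series are given by the sequences of their
  coefficients.
\<close>

definition extend_linear ::
  "(nat \<Rightarrow> 'v::ab_group_add \<Rightarrow> 'v) \<Rightarrow> 'v fps \<Rightarrow> 'v fps" where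
  "extend_linear F x = Abs_fps (\<lambda>n. \<Sum>(i, j) \<in> {(i, j). i + j = n}. F i (fps_nth x j))"

definition extend_trilinear ::
  "(nat \<Rightarrow> 'v::ab_group_add \<Rightarrow> 'v \<Rightarrow> 'v \<Rightarrow> 'v) \<Rightarrow> 'v fps \<Rightarrow> 'v fps \<Rightarrow> 'v fps \<Rightarrow> 'v fps" where
  "extend_trilinear M x y z =
     Abs_fps (\<lambda>n. \<Sum>(i, a, b, c) \<in> {(i, a, b, c). i + a + b + c = n}.
       M i (fps_nth x a) (fps_nth y b) (fps_nth z c))"

definition formal_deformation ::
  "('k::field_char_0 \<Rightarrow> 'v::ab_group_add \<Rightarrow> 'v) \<Rightarrow> 'k \<Rightarrow>
   ('v \<Rightarrow> 'v \<Rightarrow> 'v \<Rightarrow> 'v) \<Rightarrow> ('v \<Rightarrow> 'v) \<Rightarrow>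
   (nat \<Rightarrow> 'v \<Rightarrow> 'v \<Rightarrow> 'v \<Rightarrow> 'v) \<Rightarrow> (nat \<Rightarrow> 'v \<Rightarrow> 'v) \<Rightarrow> bool" where
  "formal_deformation s l \<mu> T \<mu>t Tt \<longleftrightarrow>
     (\<forall>i. alt_trilinear s (\<mu>t i)) \<and> (\<forall>i. module_hom s s (Tt i)) \<and>
     Rota_Baxter_three_Lie_algebra (fps_scale s) (fps_const l)
       (extend_trilinear \<mu>t) (extend_linear Tt) \<and>
     \<mu>t 0 = \<mu> \<and> Tt 0 = T"

definition equivalent_deformations ::
  "('k::field_char_0 \<Rightarrow> 'v::ab_group_add \<Rightarrow> 'v) \<Rightarrow>
   (nat \<Rightarrow> 'v \<Rightarrow> 'v \<Rightarrow> 'v \<Rightarrow> 'v) \<Rightarrow> (nat \<Rightarrow> 'v \<Rightarrow> 'v) \<Rightarrow>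
   (nat \<Rightarrow> 'v \<Rightarrow> 'v \<Rightarrow> 'v \<Rightarrow> 'v) \<Rightarrow> (nat \<Rightarrow> 'v \<Rightarrow> 'v) \<Rightarrow> bool" where
  "equivalent_deformations s \<mu>t Tt \<mu>t' Tt' \<longleftrightarrow>
     (\<exists>\<psi> :: nat \<Rightarrow> 'v \<Rightarrow> 'v.
        (\<forall>i. module_hom s s (\<psi> i)) \<and> \<psi> 0 = id \<and>
        (\<forall>x y z. extend_linear \<psi> (extend_trilinear \<mu>t' x y z) =
           extend_trilinear \<mu>t (extend_linear \<psi> x) (extend_linear \<psi> y) (extend_linear \<psi> z)) \<and>
        extend_linear \<psi> \<circ> extend_linear Tt' = extend_linear Tt \<circ> extend_linear \<psi>)"

definition infinitesimal ::
  "(nat \<Rightarrow> 'v \<Rightarrow> 'v \<Rightarrow> 'v \<Rightarrow> 'v) \<Rightarrow> (nat \<Rightarrow> 'v \<Rightarrow> 'v) \<Rightarrow> ('v \<Rightarrow> 'v \<Rightarrow> 'v \<Rightarrow> 'v) \<times> ('v \<Rightarrow> 'v)" where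
  "infinitesimal \<mu>t Tt = (\<mu>t 1, Tt 1)"

section \<open>Second cohomology group with adjoint coefficients\<close>

definition rho :: "('v \<Rightarrow> 'v \<Rightarrow> 'v \<Rightarrow> 'v) \<Rightarrow> 'v \<Rightarrow> 'v \<Rightarrow> 'v \<Rightarrow> 'v" where
  "rho \<mu> x y z = \<mu> x y z"

definition rho_T ::
  "('k::field_char_0 \<Rightarrow> 'v::ab_group_add \<Rightarrow> 'v) \<Rightarrow> 'k \<Rightarrow>
   ('v \<Rightarrow> 'v \<Rightarrow> 'v \<Rightarrow> 'v) \<Rightarrow> ('v \<Rightarrow> 'v) \<Rightarrow> 'v \<Rightarrow> 'v \<Rightarrow> 'v \<Rightarrow> 'v" where
  "rho_T s l \<mu> T x y z = \<mu> (T x) (T y) z - T (\<mu> (T x) y z + \<mu> x (T y) z + s l (\<mu> x y z))"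

definition delta1 ::
  "('v::ab_group_add \<Rightarrow> 'v \<Rightarrow> 'v \<Rightarrow> 'v) \<Rightarrow> ('v \<Rightarrow> 'v) \<Rightarrow> 'v \<Rightarrow> 'v \<Rightarrow> 'v \<Rightarrow> 'v" where
  "delta1 \<mu> f x y z =
     - f (\<mu> x y z) + rho \<mu> x y (f z) + rho \<mu> y z (f x) + rho \<mu> z x (f y)"

definition delta2 ::
  "('v::ab_group_add \<Rightarrow> 'v \<Rightarrow> 'v \<Rightarrow> 'v) \<Rightarrow> ('v \<Rightarrow> 'v \<Rightarrow> 'v \<Rightarrow> 'v) \<Rightarrow>
   'v \<Rightarrow> 'v \<Rightarrow> 'v \<Rightarrow> 'v \<Rightarrow> 'v \<Rightarrow> 'v" where
  "delta2 \<mu> f x1 x2 x3 x4 x5 =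
     - f (\<mu> x1 x2 x3) x4 x5 - f x3 (\<mu> x1 x2 x4) x5 - f x3 x4 (\<mu> x1 x2 x5)
     + f x1 x2 (\<mu> x3 x4 x5)
     + rho \<mu> x1 x2 (f x3 x4 x5) - rho \<mu> x3 x4 (f x1 x2 x5)
     - rho \<mu> x4 x5 (f x1 x2 x3) - rho \<mu> x5 x3 (f x1 x2 x4)"

definition partial0 :: "'v \<Rightarrow> 'v::ab_group_add \<Rightarrow> 'v" where
  "partial0 a = 0"

definition partial1 ::
  "('k::field_char_0 \<Rightarrow> 'v::ab_group_add \<Rightarrow> 'v) \<Rightarrow> 'k \<Rightarrow>
   ('v \<Rightarrow> 'v \<Rightarrow> 'v \<Rightarrow> 'v) \<Rightarrow> ('v \<Rightarrow> 'v) \<Rightarrow> ('v \<Rightarrow> 'v) \<Rightarrow> 'v \<Rightarrow> 'v \<Rightarrow> 'v \<Rightarrow> 'v" where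
  "partial1 s l \<mu> T g x y z =
     - g (derived_op s l T \<mu> x y z)
     + rho_T s l \<mu> T x y (g z) + rho_T s l \<mu> T y z (g x) + rho_T s l \<mu> T z x (g y)"

definition Phi1 :: "('v::ab_group_add \<Rightarrow> 'v) \<Rightarrow> ('v \<Rightarrow> 'v) \<Rightarrow> 'v \<Rightarrow> 'v" where
  "Phi1 T f = (f \<circ> T) - (T \<circ> f)"

definition Phi2 ::
  "('k::field_char_0 \<Rightarrow> 'v::ab_group_add \<Rightarrow> 'v) \<Rightarrow> 'k \<Rightarrow> ('v \<Rightarrow> 'v) \<Rightarrow>
   ('v \<Rightarrow> 'v \<Rightarrow> 'v \<Rightarrow> 'v) \<Rightarrow> 'v \<Rightarrow> 'v \<Rightarrow> 'v \<Rightarrow> 'v" where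
  "Phi2 s l T f x y z = f (T x) (T y) (T z) - T (derived_op s l T f x y z)"

definition cochains1 ::
  "('k::field_char_0 \<Rightarrow> 'v::ab_group_add \<Rightarrow> 'v) \<Rightarrow> (('v \<Rightarrow> 'v) \<times> 'v) set" where
  "cochains1 s = {f. module_hom s s f} \<times> UNIV"

definition cochains2 ::
  "('k::field_char_0 \<Rightarrow> 'v::ab_group_add \<Rightarrow> 'v) \<Rightarrow> (('v \<Rightarrow> 'v \<Rightarrow> 'v \<Rightarrow> 'v) \<times> ('v \<Rightarrow> 'v)) set" where
  "cochains2 s = {f. alt_trilinear s f} \<times> {g. module_hom s s g}"

text \<open>Sums, differences and zero of cochains are taken pointwise and componentwise.\<close>

definition d1 ::
  "('v::ab_group_add \<Rightarrow> 'v \<Rightarrow> 'v \<Rightarrow> 'v) \<Rightarrow> ('v \<Rightarrow> 'v) \<Rightarrow>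
   ('v \<Rightarrow> 'v) \<times> 'v \<Rightarrow> ('v \<Rightarrow> 'v \<Rightarrow> 'v \<Rightarrow> 'v) \<times> ('v \<Rightarrow> 'v)" where
  "d1 \<mu> T = (\<lambda>(f, a). (delta1 \<mu> f, - partial0 a - Phi1 T f))"

definition d2 ::
  "('k::field_char_0 \<Rightarrow> 'v::ab_group_add \<Rightarrow> 'v) \<Rightarrow> 'k \<Rightarrow>
   ('v \<Rightarrow> 'v \<Rightarrow> 'v \<Rightarrow> 'v) \<Rightarrow> ('v \<Rightarrow> 'v) \<Rightarrow>
   ('v \<Rightarrow> 'v \<Rightarrow> 'v \<Rightarrow> 'v) \<times> ('v \<Rightarrow> 'v) \<Rightarrow>
   ('v \<Rightarrow> 'v \<Rightarrow> 'v \<Rightarrow> 'v \<Rightarrow> 'v \<Rightarrow> 'v) \<times> ('v \<Rightarrow> 'v \<Rightarrow> 'v \<Rightarrow> 'v)" where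
  "d2 s l \<mu> T = (\<lambda>(f, g). (delta2 \<mu> f, - partial1 s l \<mu> T g - Phi2 s l T f))"

definition cocycle_group2 ::
  "('k::field_char_0 \<Rightarrow> 'v::ab_group_add \<Rightarrow> 'v) \<Rightarrow> 'k \<Rightarrow>
   ('v \<Rightarrow> 'v \<Rightarrow> 'v \<Rightarrow> 'v) \<Rightarrow> ('v \<Rightarrow> 'v) \<Rightarrow>
   (('v \<Rightarrow> 'v \<Rightarrow> 'v \<Rightarrow> 'v) \<times> ('v \<Rightarrow> 'v)) monoid" where
  "cocycle_group2 s l \<mu> T =
     \<lparr>carrier = {u \<in> cochains2 s. d2 s l \<mu> T u = 0}, monoid.mult = (+), monoid.one = 0\<rparr>"

definition coboundaries2 ::
  "('k::field_char_0 \<Rightarrow> 'v::ab_group_add \<Rightarrow> 'v) \<Rightarrow>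
   ('v \<Rightarrow> 'v \<Rightarrow> 'v \<Rightarrow> 'v) \<Rightarrow> ('v \<Rightarrow> 'v) \<Rightarrow> (('v \<Rightarrow> 'v \<Rightarrow> 'v \<Rightarrow> 'v) \<times> ('v \<Rightarrow> 'v)) set" where
  "coboundaries2 s \<mu> T = d1 \<mu> T ` cochains1 s"

definition cohomology_group2 ::
  "('k::field_char_0 \<Rightarrow> 'v::ab_group_add \<Rightarrow> 'v) \<Rightarrow> 'k \<Rightarrow>
   ('v \<Rightarrow> 'v \<Rightarrow> 'v \<Rightarrow> 'v) \<Rightarrow> ('v \<Rightarrow> 'v) \<Rightarrow>
   (('v \<Rightarrow> 'v \<Rightarrow> 'v \<Rightarrow> 'v) \<times> ('v \<Rightarrow> 'v)) set monoid" where
  "cohomology_group2 s l \<mu> T = cocycle_group2 s l \<mu> T Mod coboundaries2 s \<mu> T"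

end

theory Submission
  imports Defs
begin

text \<open>
  Comparing coefficients of \<open>t\<close> in the axioms of a deformation, evaluated on constant power
  series, gives the cocycle equations for the infinitesimal. Doing the same in the two equations of
  an equivalence \<open>\<psi>\<close> gives \<open>(\<mu>\<^sub>1', T\<^sub>1') - (\<mu>\<^sub>1, T\<^sub>1) = d\<^sup>1(\<psi>\<^sub>1, 0)\<close>.
\<close>

lemma alt_trilinear_add:
  assumes "alt_trilinear s f"
  shows "f (a + b) y z = f a y z + f b y z" "f x (a + b) z = f x a z + f x b z"
    "f x y (a + b) = f x y a + f x y b"
proof -
  have "module_hom s s (\<lambda>x. f x y z)" "module_hom s s (\<lambda>y. f x y z)" "module_hom s s (\<lambda>z. f x y z)"
    using assms unfolding alt_trilinear_def by blast+
  from this[THEN module_hom.add]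
  show "f (a + b) y z = f a y z + f b y z" "f x (a + b) z = f x a z + f x b z"
    "f x y (a + b) = f x y a + f x y b" .
qed

text \<open>A cyclic shift is a product of two transpositions, and each transposition changes the
  sign: expand \<open>f (x + y) (x + y) z = 0\<close> and \<open>f y (x + z) (x + z) = 0\<close>. It
  is used to compare the shifted arguments in the differentials with those in expanded
  brackets.\<close>

lemma alt_trilinear_cyclic:
  assumes "alt_trilinear s f"
  shows "f x y z = f y z x"
proof -
  note add = alt_trilinear_add[OF assms]
  have alt: "f a a b = 0" "f a b a = 0" "f b a a = 0" for a b
    using assms by (simp_all add: alt_trilinear_def)
  have "f x y z + f y x z = 0"
    using alt(1)[of "x + y" z, unfolded add] by (simp add: alt add.commute)
  moreover have "f y x z + f y z x = 0"
    using alt(3)[of y "x + z", unfolded add] by (simp add: alt add.commute)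
  ultimately show ?thesis
    by (metis add.commute add_left_imp_eq)
qed

lemma alt_trilinear_zero:
  assumes "alt_trilinear s f"
  shows "f 0 y z = 0" "f x 0 z = 0" "f x y 0 = 0"
  using alt_trilinear_add[OF assms, where a = 0 and b = 0] by simp_all

lemma extend_linear_nth_0: "fps_nth (extend_linear F x) 0 = F 0 (fps_nth x 0)"
proof -
  have "{(i, j). i + j = (0::nat)} = {(0, 0)}" by auto
  then show ?thesis by (simp add: extend_linear_def)
qed

lemma extend_linear_nth_1:
  "fps_nth (extend_linear F x) 1 = F 0 (fps_nth x 1) + F 1 (fps_nth x 0)"
proof -
  have "{(i, j). i + j = (1::nat)} = {(0, 1), (1, 0)}" by auto
  then show ?thesis by (simp add: extend_linear_def)
qed

lemma extend_trilinear_nth_0: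
  "fps_nth (extend_trilinear M x y z) 0 = M 0 (fps_nth x 0) (fps_nth y 0) (fps_nth z 0)"
proof -
  have "{(i, a, b, c). i + a + b + c = (0::nat)} = {(0, 0, 0, 0)}" by auto
  then show ?thesis by (simp add: extend_trilinear_def)
qed

lemma extend_trilinear_nth_1:
  "fps_nth (extend_trilinear M x y z) 1 =
     M 1 (fps_nth x 0) (fps_nth y 0) (fps_nth z 0) + M 0 (fps_nth x 1) (fps_nth y 0) (fps_nth z 0)
     + M 0 (fps_nth x 0) (fps_nth y 1) (fps_nth z 0) + M 0 (fps_nth x 0) (fps_nth y 0) (fps_nth z 1)"
proof -
  have "{(i, a, b, c). i + a + b + c = (1::nat)} =
    {(1, 0, 0, 0), (0, 1, 0, 0), (0, 0, 1, 0), (0, 0, 0, 1)}" by auto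
  then show ?thesis by (simp add: extend_trilinear_def add.assoc)
qed

text \<open>The weight acts on power series through the constant series \<open>fps_const l\<close>,
  hence coefficientwise.\<close>

lemma fps_scale_const_nth:
  assumes "module s"
  shows "fps_nth (fps_scale s (fps_const c) v) n = s c (fps_nth v n)"
proof -
  have "s (fps_nth (fps_const c) i) (fps_nth v (n - i)) = (if i = 0 then s c (fps_nth v n) else 0)" for i
    by (simp add: module.scale_zero_left[OF assms])
  then show ?thesis by (simp add: fps_scale_def)
qed

lemmas low_order_nth = extend_linear_nth_0 extend_linear_nth_1
  extend_trilinear_nth_0 extend_trilinear_nth_1

text \<open>This places the coset of the infinitesimal in the cohomology group, whose elements are
  cosets of cocycles.\<close>

lemma infinitesimal_cocycle:
  assumes "Rota_Baxter_three_Lie_algebra s l \<mu> T"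
    and "formal_deformation s l \<mu> T \<mu>t Tt"
  shows "infinitesimal \<mu>t Tt \<in> carrier (cocycle_group2 s l \<mu> T)"
proof -
  have mod: "module s" and alt: "alt_trilinear s \<mu>" and T: "module_hom s s T"
    using assms(1) by (auto simp: Rota_Baxter_three_Lie_algebra_def three_Lie_algebra_def)
  have alt1: "alt_trilinear s (\<mu>t 1)" and T1: "module_hom s s (Tt 1)"
    and start: "\<mu>t 0 = \<mu>" "Tt 0 = T"
    and RB: "Rota_Baxter_three_Lie_algebra (fps_scale s) (fps_const l)
       (extend_trilinear \<mu>t) (extend_linear Tt)"
    using assms(2) by (auto simp: formal_deformation_def)
  note cyclic = alt_trilinear_cyclic[OF alt]
  note zero = alt_trilinear_zero[OF alt] module_hom.zero[OF T]
  have "delta2 \<mu> (\<mu>t 1) x1 x2 x3 x4 x5 = 0" for x1 x2 x3 x4 x5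
  proof -
    let ?M = "extend_trilinear \<mu>t" and ?c = "fps_const :: 'b \<Rightarrow> 'b fps"
    have "?M (?c x1) (?c x2) (?M (?c x3) (?c x4) (?c x5)) =
        ?M (?M (?c x1) (?c x2) (?c x3)) (?c x4) (?c x5)
        + ?M (?c x3) (?M (?c x1) (?c x2) (?c x4)) (?c x5)
        + ?M (?c x3) (?c x4) (?M (?c x1) (?c x2) (?c x5))"
      using RB unfolding Rota_Baxter_three_Lie_algebra_def three_Lie_algebra_def by blast
    \<comment> \<open>Each \<open>?c x\<close> has zero coefficient at \<open>t\<close>, so in every
      nested bracket just one of the two brackets contributes \<open>\<mu>t 1\<close> and the other
      \<open>\<mu>\<close>. The unfolding of \<open>One_nat_def\<close> is there because simp
      rewrites the index \<open>1\<close> to \<open>Suc 0\<close>.\<close>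
    from arg_cong[OF this, of "\<lambda>v. fps_nth v 1"]
    have "\<mu>t 1 x1 x2 (\<mu> x3 x4 x5) + \<mu> x1 x2 (\<mu>t 1 x3 x4 x5) =
        \<mu>t 1 (\<mu> x1 x2 x3) x4 x5 + \<mu> (\<mu>t 1 x1 x2 x3) x4 x5
        + (\<mu>t 1 x3 (\<mu> x1 x2 x4) x5 + \<mu> x3 (\<mu>t 1 x1 x2 x4) x5)
        + (\<mu>t 1 x3 x4 (\<mu> x1 x2 x5) + \<mu> x3 x4 (\<mu>t 1 x1 x2 x5))"
      by (simp add: low_order_nth[unfolded One_nat_def] start zero)
    \<comment> \<open>\<open>delta2\<close> keeps the value of the cochain in the last slot of
      \<open>rho\<close>; the expansion has it in the first or second.\<close>
    moreover have "\<mu> x4 x5 (\<mu>t 1 x1 x2 x3) = \<mu> (\<mu>t 1 x1 x2 x3) x4 x5"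
      "\<mu> x5 x3 (\<mu>t 1 x1 x2 x4) = \<mu> x3 (\<mu>t 1 x1 x2 x4) x5"
      by (metis cyclic)+
    ultimately show ?thesis
      unfolding delta2_def rho_def by (simp add: algebra_simps)
  qed
  then have delta: "delta2 \<mu> (\<mu>t 1) = 0"
    by (simp add: fun_eq_iff)
  \<comment> \<open>Up to sign this sum is the second component of \<open>d2\<close> at the
    infinitesimal.\<close>
  have "partial1 s l \<mu> T (Tt 1) x y z + Phi2 s l T (\<mu>t 1) x y z = 0" for x y z
  proof -
    let ?M = "extend_trilinear \<mu>t" and ?T = "extend_linear Tt" and ?c = "fps_const :: 'b \<Rightarrow> 'b fps"
    have "?M (?T (?c x)) (?T (?c y)) (?T (?c z)) =
        ?T (derived_op (fps_scale s) (fps_const l) ?T ?M (?c x) (?c y) (?c z))"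
      using RB unfolding Rota_Baxter_three_Lie_algebra_def by blast
    \<comment> \<open>By a Leibniz rule, index \<open>1\<close> falls on one factor at a time. If it
      falls on the bracket, the terms form \<open>Phi2\<close>; on the outer operator, the first
      term of \<open>partial1\<close>; on an inner operator, the three terms on the left and nine on
      the right that make up the \<open>rho_T\<close> terms.\<close>
    from arg_cong[OF this, of "\<lambda>v. fps_nth v 1"]
    have "\<mu>t 1 (T x) (T y) (T z) + \<mu> (Tt 1 x) (T y) (T z) + \<mu> (T x) (Tt 1 y) (T z)
        + \<mu> (T x) (T y) (Tt 1 z) =
        T (derived_op s l T (\<mu>t 1) x y z) + Tt 1 (derived_op s l T \<mu> x y z)
        + T (\<mu> (Tt 1 x) (T y) z + \<mu> (T x) (Tt 1 y) z + \<mu> (Tt 1 x) y (T z) + \<mu> (T x) y (Tt 1 z)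
             + \<mu> x (Tt 1 y) (T z) + \<mu> x (T y) (Tt 1 z)
             + s l (\<mu> (Tt 1 x) y z) + s l (\<mu> x (Tt 1 y) z) + s l (\<mu> x y (Tt 1 z)))"
      by (simp add: low_order_nth[unfolded One_nat_def] start zero derived_op_def
          fps_scale_const_nth[OF mod] module.scale_right_distrib[OF mod] module_hom.add[OF T]
          fps_const_power algebra_simps)
    moreover have "\<mu> (T y) (T z) (Tt 1 x) = \<mu> (Tt 1 x) (T y) (T z)"
      "\<mu> (T z) (T x) (Tt 1 y) = \<mu> (T x) (Tt 1 y) (T z)"
      "\<mu> (T y) z (Tt 1 x) = \<mu> (Tt 1 x) (T y) z" "\<mu> y (T z) (Tt 1 x) = \<mu> (Tt 1 x) y (T z)"
      "\<mu> y z (Tt 1 x) = \<mu> (Tt 1 x) y z"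
      "\<mu> (T z) x (Tt 1 y) = \<mu> x (Tt 1 y) (T z)" "\<mu> z (T x) (Tt 1 y) = \<mu> (T x) (Tt 1 y) z"
      "\<mu> z x (Tt 1 y) = \<mu> x (Tt 1 y) z"
      by (metis cyclic)+
    ultimately show ?thesis
      unfolding partial1_def Phi2_def rho_T_def
      by (simp add: module_hom.add[OF T] algebra_simps)
  qed
  then have "- partial1 s l \<mu> T (Tt 1) - Phi2 s l T (\<mu>t 1) = 0"
    by (simp add: fun_eq_iff) (metis add_eq_0_iff diff_self)
  with delta alt1 T1 show ?thesis
    by (simp add: cocycle_group2_def cochains2_def d2_def infinitesimal_def zero_prod_def)
qed

text \<open>As \<open>\<psi> 0 = id\<close>, the coefficient of \<open>t\<close> in each equation of
  the equivalence is the difference of the infinitesimals plus terms linear in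
  \<open>\<psi> 1\<close>.\<close>

lemma infinitesimal_diff_coboundary:
  assumes "Rota_Baxter_three_Lie_algebra s l \<mu> T"
    and "formal_deformation s l \<mu> T \<mu>t Tt"
    and "formal_deformation s l \<mu> T \<mu>t' Tt'"
    and "equivalent_deformations s \<mu>t Tt \<mu>t' Tt'"
  shows "infinitesimal \<mu>t' Tt' - infinitesimal \<mu>t Tt \<in> coboundaries2 s \<mu> T"
proof -
  have alt: "alt_trilinear s \<mu>" and T: "module_hom s s T"
    using assms(1) by (auto simp: Rota_Baxter_three_Lie_algebra_def three_Lie_algebra_def)
  have start: "\<mu>t 0 = \<mu>" "Tt 0 = T" "\<mu>t' 0 = \<mu>" "Tt' 0 = T"
    using assms(2,3) by (auto simp: formal_deformation_def)
  note cyclic = alt_trilinear_cyclic[OF alt]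
  note zero = alt_trilinear_zero[OF alt] module_hom.zero[OF T]
  obtain \<psi> :: "nat \<Rightarrow> 'b \<Rightarrow> 'b" where \<psi>: "module_hom s s (\<psi> 1)" "\<psi> 0 = id"
    and \<mu>_eq: "\<And>x y z. extend_linear \<psi> (extend_trilinear \<mu>t' x y z) =
           extend_trilinear \<mu>t (extend_linear \<psi> x) (extend_linear \<psi> y) (extend_linear \<psi> z)"
    and T_eq: "extend_linear \<psi> \<circ> extend_linear Tt' = extend_linear Tt \<circ> extend_linear \<psi>"
    using assms(4) unfolding equivalent_deformations_def by blast
  have "\<mu>t' 1 x y z - \<mu>t 1 x y z = delta1 \<mu> (\<psi> 1) x y z" for x y z
  proof -
    have "\<mu>t' 1 x y z + \<psi> 1 (\<mu> x y z) =
        \<mu>t 1 x y z + \<mu> (\<psi> 1 x) y z + \<mu> x (\<psi> 1 y) z + \<mu> x y (\<psi> 1 z)"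
      using arg_cong[OF \<mu>_eq[of "fps_const x" "fps_const y" "fps_const z"], of "\<lambda>v. fps_nth v 1"]
      by (simp add: low_order_nth[unfolded One_nat_def] start zero \<psi>)
    moreover have "\<mu> y z (\<psi> 1 x) = \<mu> (\<psi> 1 x) y z" "\<mu> z x (\<psi> 1 y) = \<mu> x (\<psi> 1 y) z"
      by (metis cyclic)+
    ultimately show ?thesis
      unfolding delta1_def rho_def by (simp add: algebra_simps)
  qed
  then have "\<mu>t' 1 - \<mu>t 1 = delta1 \<mu> (\<psi> 1)"
    by (simp add: fun_eq_iff)
  \<comment> \<open>The coefficient of \<open>t\<close> reads
    \<open>Tt' 1 x + \<psi> 1 (T x) = T (\<psi> 1 x) + Tt 1 x\<close>, which explains the
    sign.\<close>
  moreover have "Tt' 1 x - Tt 1 x = - Phi1 T (\<psi> 1) x" for x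
    using arg_cong[OF fun_cong[OF T_eq, of "fps_const x"], of "\<lambda>v. fps_nth v 1"]
    by (simp add: low_order_nth[unfolded One_nat_def] start zero \<psi> Phi1_def algebra_simps)
  then have "Tt' 1 - Tt 1 = - partial0 0 - Phi1 T (\<psi> 1)"
    by (simp add: fun_eq_iff partial0_def)
  ultimately have "infinitesimal \<mu>t' Tt' - infinitesimal \<mu>t Tt = d1 \<mu> T (\<psi> 1, 0)"
    by (simp add: infinitesimal_def d1_def)
  then show ?thesis
    using \<psi>(1) by (auto simp: coboundaries2_def cochains1_def)
qed

text \<open>This puts a cocycle into its own coset.\<close>

lemma zero_coboundary:
  assumes "Rota_Baxter_three_Lie_algebra s l \<mu> T"
  shows "0 \<in> coboundaries2 s \<mu> T"
proof -
  have mod: "module s" and alt: "alt_trilinear s \<mu>" and T: "module_hom s s T"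
    using assms by (auto simp: Rota_Baxter_three_Lie_algebra_def three_Lie_algebra_def)
  have "d1 \<mu> T (0, 0) = 0"
    by (simp add: d1_def delta1_def rho_def partial0_def Phi1_def fun_eq_iff zero_prod_def
        alt_trilinear_zero[OF alt] module_hom.zero[OF T])
  moreover have "module_hom s s 0"
    using mod by (simp add: module_hom_iff module.scale_zero_right)
  ultimately show ?thesis
    by (force simp: coboundaries2_def cochains1_def image_iff)
qed

theorem theorem4p8:
  fixes s :: "'k::field_char_0 \<Rightarrow> 'v::ab_group_add \<Rightarrow> 'v"
    and l :: 'k
    and \<mu> :: "'v \<Rightarrow> 'v \<Rightarrow> 'v \<Rightarrow> 'v"
    and T :: "'v \<Rightarrow> 'v"
    and \<mu>t \<mu>t' :: "nat \<Rightarrow> 'v \<Rightarrow> 'v \<Rightarrow> 'v \<Rightarrow> 'v"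
    and Tt Tt' :: "nat \<Rightarrow> 'v \<Rightarrow> 'v"
  assumes "Rota_Baxter_three_Lie_algebra s l \<mu> T"
    and "formal_deformation s l \<mu> T \<mu>t Tt"
    and "formal_deformation s l \<mu> T \<mu>t' Tt'"
    and "equivalent_deformations s \<mu>t Tt \<mu>t' Tt'"
  shows "\<exists>c \<in> carrier (cohomology_group2 s l \<mu> T).
           infinitesimal \<mu>t Tt \<in> c \<and> infinitesimal \<mu>t' Tt' \<in> c"
proof -
  let ?u = "infinitesimal \<mu>t Tt" and ?u' = "infinitesimal \<mu>t' Tt'"
  let ?c = "coboundaries2 s \<mu> T #>\<^bsub>cocycle_group2 s l \<mu> T\<^esub> ?u"
  \<comment> \<open>The carrier of a factor group is the set of right cosets of group elements, so
    the cocycle property of \<open>?u\<close> suffices.\<close>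
  have "?c \<in> carrier (cohomology_group2 s l \<mu> T)"
    using infinitesimal_cocycle[OF assms(1,2)]
    by (auto simp: cohomology_group2_def FactGroup_def RCOSETS_def)
  moreover have "?c = (\<lambda>h. h + ?u) ` coboundaries2 s \<mu> T"
    by (auto simp: r_coset_def cocycle_group2_def)
  \<comment> \<open>Write \<open>?u = 0 + ?u\<close> and \<open>?u' = (?u' - ?u) + ?u\<close>, with
    a coboundary as first summand in both.\<close>
  then have "?u \<in> ?c" "?u' \<in> ?c"
    using zero_coboundary[OF assms(1)] infinitesimal_diff_coboundary[OF assms]
    by (force simp: image_iff)+
  ultimately show ?thesis by blast
qed

end
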